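(* Let $m\ge 1$ be an integer, let $(\mathsf H_i)_{1\le i\le m}$ be separable real Hilbert spaces, and let $\mathsf H=\mathsf H_1\oplus\cdots\oplus\mathsf H_m$ be their direct Hilbert sum. For every $n\in\mathbb N$, let $\{\tau_{i,n}\}_{1\le i\le m}\subset[0,1[$ and let $\mathsf T_n\colon\mathsf H\to\mathsf H\colon \mathsf x\mapsto(\mathsf T_{i,n}\mathsf x)_{1\le i\le m}$ be measurable and quasinonexpansive, where $\mathsf T_{i,n}\colon\mathsf H\to\mathsf H_i$. Suppose that the operators $(\mathsf T_n)_{n\in\mathbb N}$ have a common fixed point $\overline{\mathsf x}=(\overline{\mathsf x}_i)_{1\le i\le m}$ such that $$(\forall n\in\mathbb N)(\forall \mathsf x\in\mathsf H)\quad \|\mathsf T_n\mathsf x-\overline{\mathsf x}\|^2\le\sum_{i=1}^m\tau_{i,n}\|\mathsf x_i-\overline{\mathsf x}_i\|^2 .$$ Let $(\lambda_n)_{n\in\mathbb N}$ be a sequence in $]0,1]$, let $\mathsf D=\{0,1\}^m\smallsetminus\{0\}$, let $x_0$ and $(a_n)_{n\in\mathbb N}=((a_{i,n})_{1\le i\le m})_{n\in\mathbb N}$ be $\mathsf H$-valued random variables, and let $(\varepsilon_n)_{n\in\mathbb N}=((\varepsilon_{i,n})_{1\le i\le m})_{n\in\mathbb N}$ be identically distributed $\mathsf D$-valued random variables. Let $(x_n)_{n\in\mathbb N}=((x_{i,n})_{1\le i\le m})_{n\in\mathbb N}$ be defined by $$(\forall n\in\mathbb N)(\forall i\in\{1,\dots,m\})\quad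 x_{i,n+1}=x_{i,n}+\varepsilon_{i,n}\lambda_n\big(\mathsf T_{i,n}(x_{1,n},\dots,x_{m,n})+a_{i,n}-x_{i,n}\big).$$ Let $(\mathcal F_n)_{n\in\mathbb N}$ be a sequence of sub-sigma-algebras of $\mathcal F$ such that $(\forall n\in\mathbb N)$ $\sigma(x_0,\dots,x_n)\subset\mathcal F_n\subset\mathcal F_{n+1}$. Assume that the following are satisfied: [a] $\inf_{n\in\mathbb N}\lambda_n>0$. [b] There exists a sequence $(\alpha_n)_{n\in\mathbb N}$ in $[0,+\infty[$ such that $\sum_{n\in\mathbb N}\sqrt{\alpha_n}<+\infty$ and, for every $n\in\mathbb N$, $\mathsf E(\|a_n\|^2\mid\mathcal F_n)\le\alpha_n$. [c] For every $n\in\mathbb N$, $\mathcal E_n=\sigma(\varepsilon_n)$ and $\mathcal F_n$ are independent. [d] For every $i\in\{1,\dots,m\}$, $\mathsf p_i=\mathsf P[\varepsilon_{i,0}=1]>0$. Then the following hold: (i) Let $(\omega_i)_{1\le i\le m}\in\,]0,+\infty[^m$ be such that $$(\forall i\in\{1,\dots,m\})\ \ \limsup_{n\to+\infty}\tau_{i,n}<\omega_i\mathsf p_i\qquad\text{and}\qquad \max_{1\le i\le m}\omega_i\mathsf p_i=1,$$ set $$(\forall n\in\mathbb N)\quad \xi_n=\alpha_n\max_{1\le i\le m}\omega_i,\qquad \mu_n=1-\min_{1\le i\le m}\Big(\mathsf p_i-\frac{\tau_{i,n}}{\omega_i}\Big),$$ and define, for every $n\in\mathbb N$, $$\chi_n=1-\lambda_n(1-\mu_n)+\sqrt{\xi_n}\,\lambda_n(1-\lambda_n+\lambda_n\sqrt{\mu_n}),$$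 $$\overline\eta_n=\sum_{k=0}^n\Bigg[\prod_{\ell=k+1}^n\chi_\ell\Bigg]\lambda_k\big(1-\lambda_k+\lambda_k\sqrt{\mu_k}+\lambda_k\sqrt{\xi_k}\big)\sqrt{\xi_k}.$$ Then $$(\forall n\in\mathbb N)\quad \sum_{i=1}^m\omega_i\,\mathsf E\big(\|x_{i,n+1}-\overline{\mathsf x}_i\|^2\mid\mathcal F_0\big)\le\Bigg(\prod_{k=0}^n\chi_k\Bigg)\Bigg(\sum_{i=1}^m\omega_i\|x_{i,0}-\overline{\mathsf x}_i\|^2\Bigg)+\overline\eta_n\quad\mathsf P\text{-a.s.}$$ (ii) Suppose that $x_0\in L^2(\Omega,\mathcal F,\mathsf P;\mathsf H)$ and that $(\forall i\in\{1,\dots,m\})$ $\limsup_{n\to+\infty}\tau_{i,n}<1$. Then $\mathsf E\|x_n-\overline{\mathsf x}\|^2\to0$ and $x_n\to\overline{\mathsf x}$ (strongly) $\mathsf P$-a.s.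
   Context: The underlying probability space is $(\Omega,\mathcal F,\mathsf P)$. A random variable with values in a separable real Hilbert space is a measurable map from $(\Omega,\mathcal F)$ to the space equipped with its Borel $\sigma$-algebra. The $\sigma$-algebra generated by a family $\Phi$ of random variables is denoted by $\sigma(\Phi)$. The direct Hilbert sum has norm $\|\mathsf x\|^2=\sum_{i=1}^m\|\mathsf x_i\|^2$. Inequalities between conditional expectations are understood $\mathsf P$-a.s., and conditional expectations of nonnegative random variables are taken in $[0,+\infty]$. An operator $\mathsf T\colon\mathsf H\to\mathsf H$ with fixed point set $\operatorname{Fix}\mathsf T$ is quasinonexpansive if $\|\mathsf T\mathsf x-\mathsf z\|\le\|\mathsf x-\mathsf z\|$ for all $\mathsf z\in\operatorname{Fix}\mathsf T$ and all $\mathsf x\in\mathsf H$. Convention: an empty product, such as $\prod_{\ell=n+1}^n$, equals $1$. *)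

theory Defs
  imports "HOL-Probability.Probability"
begin

text \<open>
  A finite family of Hilbert spaces that may differ from one index to the next is represented by
  closed linear subspaces \<open>H i\<close> of one separable real Hilbert space \<open>'a\<close>, indexed by a finite
  type \<open>'m\<close> (so \<open>CARD('m) \<ge> 1\<close> automatically).  This loses no generality: any finite family of
  separable real Hilbert spaces embeds isometrically, as closed subspaces, in its direct Hilbert
  sum.  The library norm on \<open>'a ^ 'm\<close> is the norm of the direct Hilbert sum, see \<open>norm_vec_def\<close>.
\<close>

definition direct_sum :: "('m \<Rightarrow> 'a set) \<Rightarrow> ('a ^ 'm) set" where
  "direct_sum H = {x. \<forall>i. x $ i \<in> H i}"

definition borel_on :: "'b::topological_space set \<Rightarrow> 'b measure" where
  "borel_on S = restrict_space borel S"

definition fixed_points :: "'b set \<Rightarrow> ('b \<Rightarrow> 'b) \<Rightarrow> 'b set" where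
  "fixed_points S T = {x \<in> S. T x = x}"

definition quasinonexpansive_on :: "'b::real_normed_vector set \<Rightarrow> ('b \<Rightarrow> 'b) \<Rightarrow> bool" where
  "quasinonexpansive_on S T \<longleftrightarrow>
     T ` S \<subseteq> S \<and> (\<forall>z\<in>fixed_points S T. \<forall>x\<in>S. norm (T x - z) \<le> norm (x - z))"

text \<open>The set of nonzero 0-1 vectors, with real entries so that they can act as scalars.\<close>

definition activation_patterns :: "(real ^ 'm) set" where
  "activation_patterns = {d. (\<forall>i. d $ i \<in> {0, 1}) \<and> d \<noteq> 0}"

definition generated_sigma ::
  "'w measure \<Rightarrow> 'b measure \<Rightarrow> ('w \<Rightarrow> 'b) set \<Rightarrow> 'w set set" where
  "generated_sigma M N \<Phi> = sigma_sets (space M) {f -` A \<inter> space M | f A. f \<in> \<Phi> \<and> A \<in> sets N}"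

text \<open>
  The conditional expectation of \<open>\<parallel>f\<parallel>\<^sup>2\<close> given \<open>G\<close>, with values in \<open>[0, \<infinity>]\<close>; no integrability
  is required.
\<close>

definition cond_sq_norm ::
  "'w measure \<Rightarrow> 'w measure \<Rightarrow> ('w \<Rightarrow> 'b::real_normed_vector) \<Rightarrow> 'w \<Rightarrow> ennreal" where
  "cond_sq_norm M G f = nn_cond_exp M G (\<lambda>\<omega>. ennreal ((norm (f \<omega>))\<^sup>2))"

end

theory Submission
  imports Defs
begin

text \<open>
  Let \<open>Q\<^sub>n = (\<Sum>i. \<omega>\<^sub>i \<parallel>x\<^sub>i\<^sub>,\<^sub>n - xbar\<^sub>i\<parallel>\<^sup>2)\<close>.  Since \<open>\<epsilon>\<^sub>n\<close> is independent of \<open>F n\<close>, conditioning on \<open>F n\<close> replaces each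
  activation variable by its mean \<open>p\<^sub>i\<close>, and \<open>\<omega>\<^sub>i p\<^sub>i \<le> 1\<close> together with the bound on \<open>T n\<close> gives
  \<open>E(Q\<^sub>n\<^sub>+\<^sub>1 | F n) \<le> \<chi>\<^sub>n Q\<^sub>n + \<eta>\<^sub>n\<close>.  Iterating with the tower property yields (i).  For (ii) take
  \<open>\<omega>\<^sub>i = 1 / p\<^sub>i\<close>: then eventually \<open>\<chi>\<^sub>n \<le> \<rho> < 1\<close> while \<open>\<Sum>n. \<eta>\<^sub>n\<close> converges, so \<open>\<Sum>n. E Q\<^sub>n\<close> is finite, which
  forces both \<open>E Q\<^sub>n \<longlonglongrightarrow> 0\<close> and \<open>Q\<^sub>n \<longlonglongrightarrow> 0\<close> almost surely.
\<close>

section \<open>Conditional expectations of nonnegative variables: linearity and independent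
  indicators\<close>

lemma (in prob_space) finite_measure_subalgebraI:
  "subalgebra M G \<Longrightarrow> finite_measure_subalgebra M G"
  by (simp add: finite_measure_subalgebra_axioms_def finite_measure_subalgebra_def finite_measure_axioms)

lemma (in sigma_finite_subalgebra) nn_cond_exp_finite_sum:
  assumes "finite I" "\<And>i. i \<in> I \<Longrightarrow> f i \<in> borel_measurable M"
  shows "AE x in M. nn_cond_exp M F (\<lambda>x. \<Sum>i\<in>I. f i x) x = (\<Sum>i\<in>I. nn_cond_exp M F (f i) x)"
  using assms
proof (induction I rule: finite_induct)
  case empty
  then show ?case using nn_cond_exp_F_meas[of "\<lambda>_. 0"] by auto
next
  case (insert j I)
  have "(\<lambda>x. \<Sum>i\<in>I. f i x) \<in> borel_measurable M"
    using insert.prems by (intro borel_measurable_sum) auto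
  then show ?case
    using nn_cond_exp_sum[of "f j" "\<lambda>x. \<Sum>i\<in>I. f i x"] insert
    by (auto elim!: eventually_elim2)
qed

lemma (in sigma_finite_subalgebra) nn_cond_exp_cmult:
  assumes [measurable]: "f \<in> borel_measurable M"
  shows "AE x in M. nn_cond_exp M F (\<lambda>x. c * f x) x = c * nn_cond_exp M F f x"
  using nn_cond_exp_prod[of "\<lambda>_. c" f] by auto

lemma (in sigma_finite_subalgebra) nn_cond_exp_affine:
  assumes [measurable]: "f \<in> borel_measurable M"
  shows "AE x in M. nn_cond_exp M F (\<lambda>x. c * f x + e) x = c * nn_cond_exp M F f x + e"
  using nn_cond_exp_sum[of "\<lambda>x. c * f x" "\<lambda>_. e"] nn_cond_exp_cmult[of f c]
    nn_cond_exp_F_meas[of "\<lambda>_. e"]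
  by auto

text \<open>The \<open>G\<close>-measurable factor comes out, and the constant \<open>prob B\<close>
  is a version of the conditional expectation of the indicator because the two have equal integrals
  over every set of \<open>G\<close>. Values in \<open>ennreal\<close> spare any integrability
  condition on \<open>f\<close>.\<close>

lemma (in prob_space) nn_cond_exp_mult_indicator_indep:
  assumes "subalgebra M G" and f [measurable]: "f \<in> borel_measurable G" and [measurable]: "B \<in> events"
    and indep: "\<And>A. A \<in> sets G \<Longrightarrow> prob (A \<inter> B) = prob A * prob B"
  shows "AE \<omega> in M. nn_cond_exp M G (\<lambda>\<omega>. f \<omega> * indicator B \<omega>) \<omega> = f \<omega> * ennreal (prob B)"
proof -
  interpret finite_measure_subalgebra M G
    using assms(1) by (rule finite_measure_subalgebraI)
  have "AE \<omega> in M. ennreal (prob B) = nn_cond_exp M G (indicator B) \<omega>"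
  proof (rule nn_cond_exp_charact)
    fix A assume A: "A \<in> sets G"
    then have [measurable]: "A \<in> events" using assms(1) by (auto simp: subalgebra_def)
    have "(\<integral>\<^sup>+\<omega>\<in>A. indicator B \<omega> \<partial>M) = (\<integral>\<^sup>+\<omega>. indicator (A \<inter> B) \<omega> \<partial>M)"
      by (intro nn_integral_cong) (auto split: split_indicator)
    also have "\<dots> = ennreal (prob A * prob B)"
      using indep[OF A] by (simp add: emeasure_eq_measure)
    also have "\<dots> = (\<integral>\<^sup>+\<omega>\<in>A. ennreal (prob B) \<partial>M)"
      by (subst nn_integral_cmult_indicator) (auto simp: emeasure_eq_measure ennreal_mult mult.commute)
    finally show "(\<integral>\<^sup>+\<omega>\<in>A. indicator B \<omega> \<partial>M) = (\<integral>\<^sup>+\<omega>\<in>A. ennreal (prob B) \<partial>M)" .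
  qed auto
  with nn_cond_exp_prod[OF f, of "indicator B"] show ?thesis
    by auto
qed

section \<open>Pointwise norm estimates and a deterministic recursion\<close>

lemma norm_sq_vec: "(norm (v :: 'a::real_normed_vector ^ 'm::finite))\<^sup>2 = (\<Sum>i\<in>UNIV. (norm (v $ i))\<^sup>2)"
  by (simp add: norm_vec_def L2_set_def sum_nonneg)

text \<open>Division by zero is meant to yield \<open>0\<close> here: a vanishing weight forces the matching variable to vanish.\<close>

lemma weighted_Young:
  fixes c d s :: real
  assumes "s \<ge> 0" "r \<ge> 0" "s = 0 \<Longrightarrow> d = 0" "r = 0 \<Longrightarrow> c = 0"
  shows "2 * c * d \<le> s * c\<^sup>2 / r + r * d\<^sup>2 / s"
proof (cases "s = 0 \<or> r = 0")
  case False
  then have pos: "s > 0" "r > 0" using assms by auto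
  have "0 \<le> (s * c - r * d)\<^sup>2 / (r * s)" using pos by simp
  also have "\<dots> = s * c\<^sup>2 / r + r * d\<^sup>2 / s - 2 * c * d"
    using pos by (simp add: field_simps power2_eq_square)
  finally show ?thesis by simp
qed (use assms in auto)

text \<open>The bound is affine in \<open>e\<close>, and its coefficient of
  \<open>(norm a)\<^sup>2\<close> is free of \<open>e\<close>, so the activation can be averaged out
  even if it depends on the error. The weights \<open>s\<close> and \<open>r\<close>, later
  \<open>sqrt xi\<close> and \<open>sqrt mu\<close>, are those for which averaging leads to
  \<open>chi\<close> and \<open>eta\<close>.\<close>

lemma relaxed_norm_sq_le:
  fixes u v a y :: "'a::real_normed_vector"
  assumes e: "e = 0 \<or> e = 1" and l: "0 \<le> l" "l \<le> 1"
    and y: "y = u + (e * l) *\<^sub>R (v + a - u)"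
    and s: "0 \<le> s" "s = 0 \<Longrightarrow> a = 0" and r: "0 \<le> r" "r = 0 \<Longrightarrow> v = 0"
  shows "(norm y)\<^sup>2 \<le> (1 - e) * ((norm u)\<^sup>2 + l * (1 - l) * s * (norm u)\<^sup>2)
     + e * ((1 - l) * (norm u)\<^sup>2 + l * (norm v)\<^sup>2 + l * (1 - l) * s * (norm u)\<^sup>2
            + l\<^sup>2 * s / r * (norm v)\<^sup>2)
     + (l\<^sup>2 + l * (1 - l) / s + l\<^sup>2 * r / s) * (norm a)\<^sup>2"
  using e
proof
  \<comment> \<open>Here \<open>y = u\<close> and the other terms are slack. The term with
    \<open>l * (1 - l) * s\<close> is present in both cases so that its averaged coefficient is free
    of the activation probability.\<close>
  assume "e = 0"
  have "0 \<le> l * (1 - l) * s * (norm u)\<^sup>2" "0 \<le> (l\<^sup>2 + l * (1 - l) / s + l\<^sup>2 * r / s) * (norm a)\<^sup>2"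
    using l s r by auto
  then show ?thesis using \<open>e = 0\<close> y by simp
next
  assume "e = 1"
  then have "y = ((1 - l) *\<^sub>R u + l *\<^sub>R v) + l *\<^sub>R a"
    using y by (simp add: algebra_simps)
  then have "norm y \<le> ((1 - l) * norm u + l * norm v) + l * norm a"
    using l norm_triangle_ineq[of "(1 - l) *\<^sub>R u + l *\<^sub>R v" "l *\<^sub>R a"]
      norm_triangle_ineq[of "(1 - l) *\<^sub>R u" "l *\<^sub>R v"] by simp
  then have "(norm y)\<^sup>2 \<le> (((1 - l) * norm u + l * norm v) + l * norm a)\<^sup>2"
    by (intro power_mono) auto
  also have "\<dots> = ((1 - l) * norm u + l * norm v)\<^sup>2 + l\<^sup>2 * (norm a)\<^sup>2
      + l * (1 - l) * (2 * norm u * norm a) + l\<^sup>2 * (2 * norm v * norm a)"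
    by (simp add: power2_eq_square algebra_simps)
  \<comment> \<open>Convexity of the square, written as an identity between the real numbers
    \<open>norm u\<close> and \<open>norm v\<close>; its last term is then dropped.\<close>
  also have "((1 - l) * norm u + l * norm v)\<^sup>2
      = (1 - l) * (norm u)\<^sup>2 + l * (norm v)\<^sup>2 - l * (1 - l) * (norm u - norm v)\<^sup>2"
    by (simp add: power2_eq_square algebra_simps)
  also have "\<dots> \<le> (1 - l) * (norm u)\<^sup>2 + l * (norm v)\<^sup>2"
    using l by simp
  \<comment> \<open>The Young weights reflect the sizes expected later: in mean square
    \<open>a\<close> is of order \<open>s\<close>, and \<open>v\<close> is of order \<open>r\<close>
    relative to \<open>u\<close>.\<close>
  also have "l * (1 - l) * (2 * norm u * norm a)
      \<le> l * (1 - l) * (s * (norm u)\<^sup>2 / 1 + 1 * (norm a)\<^sup>2 / s)"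
    using l s by (intro mult_left_mono weighted_Young) auto
  also have "l\<^sup>2 * (2 * norm v * norm a) \<le> l\<^sup>2 * (s * (norm v)\<^sup>2 / r + r * (norm a)\<^sup>2 / s)"
    using s r by (intro mult_left_mono weighted_Young) auto
  finally show ?thesis
    using \<open>e = 1\<close> by (simp add: algebra_simps add_divide_distrib diff_divide_distrib)
qed

text \<open>Past an index \<open>N\<close> the factor is at most \<rho>. Summing the shifted
  recursion telescopes and bounds \<open>1 - \<rho>\<close> times each partial sum by
  \<open>b 0\<close> plus the total error; bounded partial sums of nonnegative terms
  converge.\<close>

lemma summable_contraction_recursion:
  fixes B c e :: "nat \<Rightarrow> real"
  assumes B: "\<And>n. 0 \<le> B n" "\<And>n. B (Suc n) \<le> c n * B n + e n"
    and c: "eventually (\<lambda>n. c n \<le> \<rho>) sequentially" "\<rho> < 1"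
    and e: "summable e" "\<And>n. 0 \<le> e n"
  shows "summable B"
proof -
  obtain N where N: "\<And>n. n \<ge> N \<Longrightarrow> c n \<le> \<rho>"
    using c(1) by (auto simp: eventually_sequentially)
  define b where "b n = B (n + N)" for n
  have step: "b (Suc n) \<le> \<rho> * b n + e (n + N)" for n
    using B(2)[of "n + N"] mult_right_mono[OF N[of "n + N"] B(1)[of "n + N"]] by (simp add: b_def)
  have "(1 - \<rho>) * (\<Sum>i<n. b i) \<le> b 0 + (\<Sum>i. e (i + N))" for n
  proof -
    \<comment> \<open>The term \<open>- b n\<close> is what makes the induction close; it is
      discarded afterwards.\<close>
    have "(1 - \<rho>) * (\<Sum>i<n. b i) \<le> b 0 - b n + (\<Sum>i<n. e (i + N))"
    proof (induction n)
      case (Suc n)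
      show ?case using Suc step[of n] by (simp add: algebra_simps)
    qed simp
    moreover have "(\<Sum>i<n. e (i + N)) \<le> (\<Sum>i. e (i + N))"
      using e by (intro sum_le_suminf) auto
    moreover have "0 \<le> b n" using B(1) by (simp add: b_def)
    ultimately show ?thesis by linarith
  qed
  then have "(\<Sum>i<n. b i) \<le> (b 0 + (\<Sum>i. e (i + N))) / (1 - \<rho>)" for n
    using c(2) by (simp add: field_simps)
  then have "summable b"
    using B(1) by (intro summableI_nonneg_bounded) (auto simp: b_def)
  then show ?thesis
    unfolding b_def by (rule iffD1[OF summable_iff_shift])
qed

section \<open>The one-step conditional estimate\<close>

text \<open>
  The activation events \<open>E i\<close> may depend on the error \<open>a\<close>, so the cross terms cannot be factored;
  Young's inequality with the deterministic weights \<open>sqrt xi\<close> and \<open>sqrt mu\<close> separates them pointwise,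
  which replaces a conditional Cauchy-Schwarz inequality.
\<close>

lemma (in prob_space) cond_exp_block_step:
  fixes u v a y :: "'a \<Rightarrow> 'b::real_normed_vector ^ 'm::finite"
  assumes G: "subalgebra M G"
    and u [measurable]: "\<And>i. (\<lambda>\<omega>. norm (u \<omega> $ i)) \<in> borel_measurable G"
    and v [measurable]: "\<And>i. (\<lambda>\<omega>. norm (v \<omega> $ i)) \<in> borel_measurable G"
    and a [measurable]: "(\<lambda>\<omega>. norm (a \<omega>)) \<in> borel_measurable M"
    and ym [measurable]: "\<And>i. (\<lambda>\<omega>. norm (y \<omega> $ i)) \<in> borel_measurable M"
    and E [measurable]: "\<And>i. E i \<in> events"
    and indep: "\<And>A i. A \<in> sets G \<Longrightarrow> prob (A \<inter> E i) = prob A * prob (E i)"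
    and y: "\<And>\<omega> i. \<omega> \<in> space M \<Longrightarrow>
       y \<omega> $ i = u \<omega> $ i + (indicator (E i) \<omega> * l) *\<^sub>R (v \<omega> $ i + a \<omega> $ i - u \<omega> $ i)"
    and uv: "\<And>\<omega>. \<omega> \<in> space M \<Longrightarrow> (norm (v \<omega>))\<^sup>2 \<le> (\<Sum>i\<in>UNIV. t i * (norm (u \<omega> $ i))\<^sup>2)"
    and t: "\<And>i. 0 \<le> t i" and w: "\<And>i. 0 < w i" "\<And>i. w i * prob (E i) \<le> 1"
    and l: "0 \<le> l" "l \<le> 1" and \<alpha>: "0 \<le> \<alpha>" "AE \<omega> in M. cond_sq_norm M G a \<omega> \<le> ennreal \<alpha>"
    and xi: "xi = \<alpha> * Max (range w)"
    and mu: "mu = 1 - Min (range (\<lambda>i. prob (E i) - t i / w i))"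
    and chi: "chi = 1 - l * (1 - mu) + sqrt xi * l * (1 - l + l * sqrt mu)"
    and eta: "eta = l * (1 - l + l * sqrt mu + l * sqrt xi) * sqrt xi"
  shows "AE \<omega> in M. nn_cond_exp M G (\<lambda>\<omega>. ennreal (\<Sum>i\<in>UNIV. w i * (norm (y \<omega> $ i))\<^sup>2)) \<omega>
     \<le> ennreal (chi * (\<Sum>i\<in>UNIV. w i * (norm (u \<omega> $ i))\<^sup>2) + eta)"
proof -
  interpret finite_measure_subalgebra M G
    using G by (rule finite_measure_subalgebraI)
  note meas = measurable_from_subalg[OF G]
  have [measurable]: "(\<lambda>\<omega>. norm (u \<omega> $ i)) \<in> borel_measurable M" 
    "(\<lambda>\<omega>. norm (v \<omega> $ i)) \<in> borel_measurable M" for i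
    using u v meas by blast+
  define W where "W = Max (range w)"
  define s where "s = sqrt xi"
  define r where "r = sqrt mu"
  \<comment> \<open>The total coefficient of the squared error, arranged so that
    \<open>K * s\<^sup>2 = eta\<close>; for \<open>s = 0\<close> both sides vanish.\<close>
  define K where "K = l\<^sup>2 + l * (1 - l) / s + l\<^sup>2 * r / s"
  \<comment> \<open>\<open>A0 i\<close> and \<open>A1 i\<close> are the \<open>G\<close>-measurable
    parts of the weighted bound for block \<open>i\<close> when it is inactive and active,
    respectively.\<close>
  define A0 where "A0 i \<omega> = w i * ((norm (u \<omega> $ i))\<^sup>2 + l * (1 - l) * s * (norm (u \<omega> $ i))\<^sup>2)" for i \<omega>
  define A1 where "A1 i \<omega> = w i * ((1 - l) * (norm (u \<omega> $ i))\<^sup>2 + l * (norm (v \<omega> $ i))\<^sup>2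
     + l * (1 - l) * s * (norm (u \<omega> $ i))\<^sup>2 + l\<^sup>2 * s / r * (norm (v \<omega> $ i))\<^sup>2)" for i \<omega>
  define q where "q \<omega> = (\<Sum>i\<in>UNIV. w i * (norm (u \<omega> $ i))\<^sup>2)" for \<omega>
  have wW: "w i \<le> W" for i by (simp add: W_def)
  then have W: "W > 0" using w(1) less_le_trans by blast
  have mu_i: "prob (E i) - t i / w i \<ge> 1 - mu" for i
    by (simp add: mu)
  \<comment> \<open>The minimum in \<open>mu\<close> gives
    \<open>t i / w i \<le> prob (E i) - (1 - mu)\<close>, and a probability is at most 1.
    Nonnegativity of \<open>mu\<close> follows from this.\<close>
  have mu_t: "t i \<le> mu * w i" for i
  proof -
    have "t i / w i \<le> mu" using mu_i[of i] prob_le_1[of "E i"] by linarith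
    then show ?thesis using w(1)[of i] by (simp add: field_simps)
  qed
  have mu0: "0 \<le> mu"
    using mu_t t w(1) by (metis mult.commute order_trans linorder_not_le mult_pos_neg)
  have xi0: "0 \<le> xi" using \<alpha> W by (simp add: xi W_def)
  have s0: "0 \<le> s" and r0: "0 \<le> r" and s2: "s\<^sup>2 = xi" and r2: "r\<^sup>2 = mu"
    using xi0 mu0 by (auto simp: s_def r_def)
  have K0: "0 \<le> K" using l s0 r0 by (auto simp: K_def)
  have A_nonneg: "0 \<le> A0 i \<omega>" "0 \<le> A1 i \<omega>" for i \<omega>
    using l s0 r0 w(1)[of i] by (auto simp: A0_def A1_def intro!: mult_nonneg_nonneg add_nonneg_nonneg)
  have A0m [measurable]: "A0 i \<in> borel_measurable G" and A1m [measurable]: "A1 i \<in> borel_measurable G" for i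
    unfolding A0_def A1_def by measurable
  note [measurable] = meas[OF A0m] meas[OF A1m]
  \<comment> \<open>Besides bounding \<open>v\<close>, this shows \<open>v = 0\<close> when
    \<open>r = 0\<close>, as the Young weights with a zero denominator require.\<close>
  have vq: "(norm (v \<omega>))\<^sup>2 \<le> mu * q \<omega>" if "\<omega> \<in> space M" for \<omega>
  proof -
    have "(\<Sum>i\<in>UNIV. t i * (norm (u \<omega> $ i))\<^sup>2) \<le> (\<Sum>i\<in>UNIV. mu * w i * (norm (u \<omega> $ i))\<^sup>2)"
      using mu_t by (intro sum_mono mult_right_mono) auto
    then show ?thesis using uv[OF that] by (simp add: q_def sum_distrib_left mult.assoc)
  qed
  \<comment> \<open>The analogous degenerate case for the error: since \<open>W > 0\<close>,
    \<open>s = 0\<close> forces \<alpha> to vanish, so the squared error has integral zero.\<close>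
  have a0: "AE \<omega> in M. s = 0 \<longrightarrow> a \<omega> = 0"
  proof (cases "s = 0")
    case True
    then have "\<alpha> = 0" using s2 W by (simp add: xi W_def)
    then have "AE \<omega> in M. cond_sq_norm M G a \<omega> = 0" using \<alpha>(2) by simp
    then have "(\<integral>\<^sup>+\<omega>. 1 * nn_cond_exp M G (\<lambda>\<omega>. ennreal ((norm (a \<omega>))\<^sup>2)) \<omega> \<partial>M) = 0"
      by (subst nn_integral_0_iff_AE) (auto simp: cond_sq_norm_def)
    then have "(\<integral>\<^sup>+\<omega>. ennreal ((norm (a \<omega>))\<^sup>2) \<partial>M) = 0"
      by (subst (asm) nn_cond_exp_intg) auto
    then show ?thesis by (subst (asm) nn_integral_0_iff_AE) auto
  qed simp
  \<comment> \<open>Each summand is a \<open>G\<close>-measurable function times the indicator of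
    \<open>E i\<close> or of its complement, and the error carries a constant factor, so every piece
    can be conditioned separately.\<close>
  define g where "g \<omega> = (\<Sum>i\<in>UNIV. ennreal (A0 i \<omega>) * indicator (space M - E i) \<omega> + ennreal (A1 i \<omega>) * indicator (E i) \<omega>)
     + ennreal (K * W) * ennreal ((norm (a \<omega>))\<^sup>2)" for \<omega>
  have [measurable]: "g \<in> borel_measurable M" unfolding g_def by measurable
  have "AE \<omega> in M. ennreal (\<Sum>i\<in>UNIV. w i * (norm (y \<omega> $ i))\<^sup>2) \<le> g \<omega>"
    using a0 AE_space
  proof eventually_elim
    case (elim \<omega>)
    have v0: "v \<omega> = 0" if "r = 0" using vq[OF elim(2)] r2 that by simp
    let ?e = "\<lambda>i. indicator (E i) \<omega> :: real"
    have "(\<Sum>i\<in>UNIV. w i * (norm (y \<omega> $ i))\<^sup>2)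
        \<le> (\<Sum>i\<in>UNIV. ((1 - ?e i) * A0 i \<omega> + ?e i * A1 i \<omega>) + K * W * (norm (a \<omega> $ i))\<^sup>2)"
    proof (rule sum_mono)
      fix i
      have "(norm (y \<omega> $ i))\<^sup>2 \<le>
         (1 - ?e i) * ((norm (u \<omega> $ i))\<^sup>2 + l * (1 - l) * s * (norm (u \<omega> $ i))\<^sup>2)
         + ?e i * ((1 - l) * (norm (u \<omega> $ i))\<^sup>2 + l * (norm (v \<omega> $ i))\<^sup>2
              + l * (1 - l) * s * (norm (u \<omega> $ i))\<^sup>2 + l\<^sup>2 * s / r * (norm (v \<omega> $ i))\<^sup>2)
         + K * (norm (a \<omega> $ i))\<^sup>2" (is "_ \<le> ?R")
        unfolding K_def
        by (rule relaxed_norm_sq_le[OF _ l y[OF elim(2)] s0 _ r0])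
           (use elim(1) v0 in \<open>auto simp: indicator_def\<close>)
      then have "w i * (norm (y \<omega> $ i))\<^sup>2 \<le> w i * ?R"
        using w(1)[of i] by simp
      also have "\<dots> = (1 - ?e i) * A0 i \<omega> + ?e i * A1 i \<omega> + w i * (K * (norm (a \<omega> $ i))\<^sup>2)"
        by (simp add: A0_def A1_def algebra_simps)
      \<comment> \<open>A common weight lets the error coordinates recombine into
        \<open>norm (a \<omega>)\<close>, whose conditional second moment is the one that is
        controlled.\<close>
      also have "w i * (K * (norm (a \<omega> $ i))\<^sup>2) \<le> W * (K * (norm (a \<omega> $ i))\<^sup>2)"
        using wW K0 by (intro mult_right_mono) auto
      finally show "w i * (norm (y \<omega> $ i))\<^sup>2
          \<le> ((1 - ?e i) * A0 i \<omega> + ?e i * A1 i \<omega>) + K * W * (norm (a \<omega> $ i))\<^sup>2"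
        by (simp add: mult_ac)
    qed
    also have "\<dots> = (\<Sum>i\<in>UNIV. (1 - ?e i) * A0 i \<omega> + ?e i * A1 i \<omega>) + K * W * (norm (a \<omega>))\<^sup>2"
      by (simp add: sum.distrib norm_sq_vec sum_distrib_left)
    finally have "ennreal (\<Sum>i\<in>UNIV. w i * (norm (y \<omega> $ i))\<^sup>2)
       \<le> ennreal ((\<Sum>i\<in>UNIV. (1 - ?e i) * A0 i \<omega> + ?e i * A1 i \<omega>) + K * W * (norm (a \<omega>))\<^sup>2)"
      by (rule ennreal_leI)
    also have "\<dots> = ennreal (\<Sum>i\<in>UNIV. (1 - ?e i) * A0 i \<omega> + ?e i * A1 i \<omega>) + ennreal (K * W * (norm (a \<omega>))\<^sup>2)"
      using A_nonneg K0 W by (intro ennreal_plus sum_nonneg) (auto simp: indicator_def)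
    also have "ennreal (\<Sum>i\<in>UNIV. (1 - ?e i) * A0 i \<omega> + ?e i * A1 i \<omega>)
        = (\<Sum>i\<in>UNIV. ennreal ((1 - ?e i) * A0 i \<omega> + ?e i * A1 i \<omega>))"
      using A_nonneg by (intro sum_ennreal[symmetric]) (auto simp: indicator_def)
    also have "\<dots> = (\<Sum>i\<in>UNIV. ennreal (A0 i \<omega>) * indicator (space M - E i) \<omega> + ennreal (A1 i \<omega>) * indicator (E i) \<omega>)"
      using elim(2) by (intro sum.cong) (auto simp: indicator_def)
    also have "ennreal (K * W * (norm (a \<omega>))\<^sup>2) = ennreal (K * W) * ennreal ((norm (a \<omega>))\<^sup>2)"
      using K0 W by (intro ennreal_mult) auto
    finally show ?case by (simp add: g_def)
  qed
  then have 1: "AE \<omega> in M. nn_cond_exp M G (\<lambda>\<omega>. ennreal (\<Sum>i\<in>UNIV. w i * (norm (y \<omega> $ i))\<^sup>2)) \<omega>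
     \<le> nn_cond_exp M G g \<omega>"
    by (rule nn_cond_exp_mono) measurable
  have ind1: "AE \<omega> in M. \<forall>i. nn_cond_exp M G (\<lambda>\<omega>. ennreal (A1 i \<omega>) * indicator (E i) \<omega>) \<omega>
      = ennreal (A1 i \<omega>) * ennreal (prob (E i))"
    by (unfold AE_all_countable) (auto intro!: nn_cond_exp_mult_indicator_indep G indep)
  have compl: "prob (A \<inter> (space M - E i)) = prob A * prob (space M - E i)" if A: "A \<in> sets G" for A i
  proof -
    have "A \<in> events" using A G by (auto simp: subalgebra_def)
    moreover have "A \<inter> (space M - E i) = A - A \<inter> E i"
      using sets.sets_into_space[OF \<open>A \<in> events\<close>] by auto
    ultimately show ?thesis
      using indep[OF A] by (simp add: finite_measure_Diff prob_compl algebra_simps)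
  qed
  have ind0: "AE \<omega> in M. \<forall>i. nn_cond_exp M G (\<lambda>\<omega>. ennreal (A0 i \<omega>) * indicator (space M - E i) \<omega>) \<omega>
      = ennreal (A0 i \<omega>) * ennreal (prob (space M - E i))"
    by (unfold AE_all_countable) (auto intro!: nn_cond_exp_mult_indicator_indep G compl)
  have sums: "AE \<omega> in M. \<forall>i. nn_cond_exp M G (\<lambda>\<omega>. ennreal (A0 i \<omega>) * indicator (space M - E i) \<omega>) \<omega>
      + nn_cond_exp M G (\<lambda>\<omega>. ennreal (A1 i \<omega>) * indicator (E i) \<omega>) \<omega>
     = nn_cond_exp M G (\<lambda>\<omega>. ennreal (A0 i \<omega>) * indicator (space M - E i) \<omega> + ennreal (A1 i \<omega>) * indicator (E i) \<omega>) \<omega>"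
    by (unfold AE_all_countable) (auto intro!: nn_cond_exp_sum)
  let ?S = "\<lambda>\<omega>. \<Sum>i\<in>UNIV. ennreal (A0 i \<omega>) * indicator (space M - E i) \<omega> + ennreal (A1 i \<omega>) * indicator (E i) \<omega>"
  have "AE \<omega> in M. nn_cond_exp M G ?S \<omega> = (\<Sum>i\<in>UNIV. nn_cond_exp M G (\<lambda>\<omega>. ennreal (A0 i \<omega>) * indicator (space M - E i) \<omega> + ennreal (A1 i \<omega>) * indicator (E i) \<omega>) \<omega>)"
    by (rule nn_cond_exp_finite_sum) auto
  moreover have "AE \<omega> in M. nn_cond_exp M G ?S \<omega> + nn_cond_exp M G (\<lambda>\<omega>. ennreal (K * W) * ennreal ((norm (a \<omega>))\<^sup>2)) \<omega> = nn_cond_exp M G g \<omega>"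
    unfolding g_def by (rule nn_cond_exp_sum) measurable
  moreover have "AE \<omega> in M. nn_cond_exp M G (\<lambda>\<omega>. ennreal (K * W) * ennreal ((norm (a \<omega>))\<^sup>2)) \<omega>
     = ennreal (K * W) * cond_sq_norm M G a \<omega>"
    unfolding cond_sq_norm_def by (rule nn_cond_exp_cmult) measurable
  ultimately have 2: "AE \<omega> in M. nn_cond_exp M G g \<omega> \<le>
      (\<Sum>i\<in>UNIV. ennreal (A0 i \<omega>) * ennreal (prob (space M - E i)) + ennreal (A1 i \<omega>) * ennreal (prob (E i)))
      + ennreal (K * W) * ennreal \<alpha>"
    using ind0 ind1 sums \<alpha>(2)
  proof eventually_elim
    case (elim \<omega>)
    have "nn_cond_exp M G g \<omega> = (\<Sum>i\<in>UNIV. ennreal (A0 i \<omega>) * ennreal (prob (space M - E i)) + ennreal (A1 i \<omega>) * ennreal (prob (E i)))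
      + ennreal (K * W) * cond_sq_norm M G a \<omega>"
      using elim(1-5) elim(6)[rule_format, symmetric] by simp
    also have "\<dots> \<le> (\<Sum>i\<in>UNIV. ennreal (A0 i \<omega>) * ennreal (prob (space M - E i)) + ennreal (A1 i \<omega>) * ennreal (prob (E i)))
      + ennreal (K * W) * ennreal \<alpha>"
      using elim(7) by (intro add_left_mono mult_left_mono) auto
    finally show ?case .
  qed
  have 3: "(\<Sum>i\<in>UNIV. ennreal (A0 i \<omega>) * ennreal (prob (space M - E i)) + ennreal (A1 i \<omega>) * ennreal (prob (E i)))
      + ennreal (K * W) * ennreal \<alpha> \<le> ennreal (chi * q \<omega> + eta)" (is "?L \<le> _") if \<omega>: "\<omega> \<in> space M" for \<omega>
  proof -
    let ?p = "\<lambda>i. prob (E i)"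
    have "?L = (\<Sum>i\<in>UNIV. ennreal (A0 i \<omega> * (1 - ?p i) + A1 i \<omega> * ?p i)) + ennreal (K * W * \<alpha>)"
      using A_nonneg K0 W \<alpha>(1) by (simp add: ennreal_mult ennreal_plus prob_compl)
    also have "\<dots> = ennreal (\<Sum>i\<in>UNIV. A0 i \<omega> * (1 - ?p i) + A1 i \<omega> * ?p i) + ennreal (K * W * \<alpha>)"
      using A_nonneg by (intro arg_cong2[of _ _ _ _ "(+)"] sum_ennreal refl) auto
    also have "\<dots> = ennreal ((\<Sum>i\<in>UNIV. A0 i \<omega> * (1 - ?p i) + A1 i \<omega> * ?p i) + K * W * \<alpha>)"
      using A_nonneg K0 W \<alpha>(1) by (intro ennreal_plus[symmetric] sum_nonneg) auto
    also have "\<dots> \<le> ennreal (chi * q \<omega> + eta)"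
    proof (rule ennreal_leI)
      have "(\<Sum>i\<in>UNIV. A0 i \<omega> * (1 - ?p i) + A1 i \<omega> * ?p i)
          = (\<Sum>i\<in>UNIV. (1 - l * ?p i + l * (1 - l) * s) * (w i * (norm (u \<omega> $ i))\<^sup>2)
              + (l + l\<^sup>2 * s / r) * (w i * ?p i * (norm (v \<omega> $ i))\<^sup>2))"
        by (intro sum.cong) (auto simp: A0_def A1_def algebra_simps)
      \<comment> \<open>By the definition of \<open>mu\<close>,
        \<open>w i * prob (E i) \<ge> w i * (1 - mu) + t i\<close>, so the coefficient of
        \<open>u\<close> can give up an extra \<open>l * t i\<close>. It is saved to cancel
        \<open>l * (norm (v \<omega>))\<^sup>2\<close>, once \<open>w i * prob (E i) \<le> 1\<close>
        has removed the weights from \<open>v\<close>.\<close>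
      also have "\<dots> \<le> (\<Sum>i\<in>UNIV. ((1 - l * (1 - mu) + l * (1 - l) * s) * w i - l * t i) * (norm (u \<omega> $ i))\<^sup>2
              + (l + l\<^sup>2 * s / r) * (norm (v \<omega> $ i))\<^sup>2)"
      proof (intro sum_mono add_mono)
        fix i
        have "t i / w i \<le> ?p i - (1 - mu)" using mu_i[of i] by simp
        then have "t i \<le> (?p i - (1 - mu)) * w i" using w(1)[of i] by (simp add: field_simps)
        then have "l * t i \<le> l * ((?p i - (1 - mu)) * w i)" using l by (intro mult_left_mono) auto
        then have "(1 - l * ?p i + l * (1 - l) * s) * w i \<le> (1 - l * (1 - mu) + l * (1 - l) * s) * w i - l * t i"
          by (simp add: algebra_simps)
        then show "(1 - l * ?p i + l * (1 - l) * s) * (w i * (norm (u \<omega> $ i))\<^sup>2)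
          \<le> ((1 - l * (1 - mu) + l * (1 - l) * s) * w i - l * t i) * (norm (u \<omega> $ i))\<^sup>2"
          by (metis mult.assoc mult_right_mono zero_le_power2)
        have "w i * ?p i * (norm (v \<omega> $ i))\<^sup>2 \<le> 1 * (norm (v \<omega> $ i))\<^sup>2"
          using w(2) by (intro mult_right_mono) auto
        then show "(l + l\<^sup>2 * s / r) * (w i * ?p i * (norm (v \<omega> $ i))\<^sup>2) \<le> (l + l\<^sup>2 * s / r) * (norm (v \<omega> $ i))\<^sup>2"
          using l s0 r0 by (intro mult_left_mono) auto
      qed
      also have "\<dots> = (1 - l * (1 - mu) + l * (1 - l) * s) * q \<omega>
          + l * ((norm (v \<omega>))\<^sup>2 - (\<Sum>i\<in>UNIV. t i * (norm (u \<omega> $ i))\<^sup>2)) + l\<^sup>2 * s / r * (norm (v \<omega>))\<^sup>2"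
        by (simp add: q_def norm_sq_vec sum.distrib sum_subtractf sum_distrib_left algebra_simps)
      \<comment> \<open>The bracket is nonpositive by \<open>uv\<close>. In the last term
        \<open>vq\<close> supplies a factor \<open>r\<^sup>2\<close> that absorbs the quotient by
        \<open>r\<close> and leaves the \<open>sqrt mu\<close> contribution to \<open>chi\<close>;
        this also holds for \<open>r = 0\<close>.\<close>
      also have "\<dots> \<le> (1 - l * (1 - mu) + l * (1 - l) * s) * q \<omega> + l * 0 + l\<^sup>2 * s / r * (r\<^sup>2 * q \<omega>)"
        using l s0 r0 uv[OF \<omega>] vq[OF \<omega>] r2 by (intro add_mono mult_left_mono order_refl) auto
      also have "\<dots> = chi * q \<omega>"
        by (simp add: chi s_def[symmetric] r_def[symmetric] power2_eq_square algebra_simps)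
      finally have "(\<Sum>i\<in>UNIV. A0 i \<omega> * (1 - ?p i) + A1 i \<omega> * ?p i) \<le> chi * q \<omega>" .
      moreover have "K * W * \<alpha> = K * s\<^sup>2" by (simp add: s2 xi W_def)
      moreover have "K * s\<^sup>2 = eta"
        by (cases "s = 0")
          (auto simp: K_def eta s_def[symmetric] r_def[symmetric] power2_eq_square field_simps)
      ultimately show "(\<Sum>i\<in>UNIV. A0 i \<omega> * (1 - ?p i) + A1 i \<omega> * ?p i) + K * W * \<alpha> \<le> chi * q \<omega> + eta"
        by simp
    qed
    finally show ?thesis .
  qed
  show ?thesis
    using 1 2 AE_space
    by eventually_elim (use 3 in \<open>auto simp: q_def intro: order_trans\<close>)
qed

section \<open>Iterating a conditional affine recursion\<close>

text \<open>By the tower property one may condition on \<open>F (Suc n)\<close> first. The one-step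
  bound is then affine in \<open>Q (Suc n)\<close> with constant nonnegative coefficients, so it
  passes through the conditioning on \<open>F 0\<close>.\<close>

lemma (in prob_space) cond_exp_affine_recursion:
  fixes Q :: "nat \<Rightarrow> 'a \<Rightarrow> real"
  assumes F: "\<And>n. subalgebra M (F n)" "\<And>n. sets (F n) \<subseteq> sets (F (Suc n))"
    and Qm: "\<And>n. Q n \<in> borel_measurable (F n)" and Q0: "\<And>n \<omega>. 0 \<le> Q n \<omega>"
    and step: "\<And>n. AE \<omega> in M. nn_cond_exp M (F n) (\<lambda>\<omega>. ennreal (Q (Suc n) \<omega>)) \<omega> \<le> ennreal (c n * Q n \<omega> + e n)"
    and c: "\<And>n. 0 \<le> c n" and e: "\<And>n. 0 \<le> e n"
  shows "AE \<omega> in M. nn_cond_exp M (F 0) (\<lambda>\<omega>. ennreal (Q (Suc n) \<omega>)) \<omega>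
    \<le> ennreal ((\<Prod>k=0..n. c k) * Q 0 \<omega> + (\<Sum>k=0..n. (\<Prod>l=k+1..n. c l) * e k))"
proof (induction n)
  case 0
  show ?case using step[of 0] by simp
next
  case (Suc n)
  interpret finite_measure_subalgebra M "F 0"
    using F(1) by (rule finite_measure_subalgebraI)
  have [measurable]: "Q n \<in> borel_measurable M" for n
    using measurable_from_subalg[OF F(1) Qm] .
  let ?q = "\<lambda>\<omega>. ennreal (Q (Suc (Suc n)) \<omega>)"
  have "sets (F 0) \<subseteq> sets (F (Suc n))"
    using lift_Suc_mono_le[of "\<lambda>n. sets (F n)" 0 "Suc n"] F(2) by auto
  then have "subalgebra (F (Suc n)) (F 0)"
    using F(1) by (auto simp: subalgebra_def)
  then have "AE \<omega> in M. nn_cond_exp M (F 0) ?q \<omega> = nn_cond_exp M (F 0) (nn_cond_exp M (F (Suc n)) ?q) \<omega>"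
    by (intro nn_cond_exp_nested_subalg F(1)) measurable
  moreover have "AE \<omega> in M. nn_cond_exp M (F 0) (nn_cond_exp M (F (Suc n)) ?q) \<omega>
      \<le> nn_cond_exp M (F 0) (\<lambda>\<omega>. ennreal (c (Suc n)) * ennreal (Q (Suc n) \<omega>) + ennreal (e (Suc n))) \<omega>"
    by (rule nn_cond_exp_mono)
      (use step[of "Suc n"] in \<open>simp_all add: ennreal_mult Q0 c e\<close>)
  moreover have "AE \<omega> in M. nn_cond_exp M (F 0) (\<lambda>\<omega>. ennreal (c (Suc n)) * ennreal (Q (Suc n) \<omega>) + ennreal (e (Suc n))) \<omega>
      = ennreal (c (Suc n)) * nn_cond_exp M (F 0) (\<lambda>\<omega>. ennreal (Q (Suc n) \<omega>)) \<omega> + ennreal (e (Suc n))"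
    by (rule nn_cond_exp_affine) measurable
  ultimately show ?case
    using Suc
  proof eventually_elim
    case (elim \<omega>)
    let ?r = "(\<Prod>k=0..n. c k) * Q 0 \<omega> + (\<Sum>k=0..n. (\<Prod>l=k+1..n. c l) * e k)"
    have "0 \<le> ?r" using c e Q0 by (intro add_nonneg_nonneg mult_nonneg_nonneg sum_nonneg prod_nonneg) auto
    note elim(1) also note elim(2) also note elim(3)
    also have "ennreal (c (Suc n)) * nn_cond_exp M (F 0) (\<lambda>\<omega>. ennreal (Q (Suc n) \<omega>)) \<omega> + ennreal (e (Suc n))
        \<le> ennreal (c (Suc n)) * ennreal ?r + ennreal (e (Suc n))"
      by (intro add_mono mult_left_mono elim(4) order_refl) auto
    also have "\<dots> = ennreal (c (Suc n) * ?r + e (Suc n))"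
      using ennreal_mult[OF c \<open>0 \<le> ?r\<close>] ennreal_plus[OF mult_nonneg_nonneg[OF c \<open>0 \<le> ?r\<close>] e]
      by metis
    \<comment> \<open>The new factor enters every earlier product, while the new summand
      \<open>k = Suc n\<close> carries the empty product.\<close>
    also have "c (Suc n) * ?r + e (Suc n)
      = (\<Prod>k=0..Suc n. c k) * Q 0 \<omega> + (\<Sum>k=0..Suc n. (\<Prod>l=k+1..Suc n. c l) * e k)"
      by (simp add: algebra_simps sum_distrib_left prod.nat_ivl_Suc')
    finally show ?case .
  qed
qed

text \<open>Expectations obey a deterministic contraction with summable errors, hence are summable.
  This gives both limits: the terms vanish, and exchanging sum and integral makes the random series
  finite almost surely, so no supermartingale convergence theorem is involved.\<close>

lemma (in prob_space) cond_exp_affine_contraction: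
  fixes Q :: "nat \<Rightarrow> 'a \<Rightarrow> real"
  assumes F: "\<And>n. subalgebra M (F n)"
    and Qm: "\<And>n. Q n \<in> borel_measurable M" and Q0: "\<And>n \<omega>. 0 \<le> Q n \<omega>"
    and step: "\<And>n. AE \<omega> in M. nn_cond_exp M (F n) (\<lambda>\<omega>. ennreal (Q (Suc n) \<omega>)) \<omega> \<le> ennreal (c n * Q n \<omega> + e n)"
    and c: "\<And>n. 0 \<le> c n" and e: "\<And>n. 0 \<le> e n" "summable e"
    and \<rho>: "eventually (\<lambda>n. c n \<le> \<rho>) sequentially" "\<rho> < 1"
    and fin: "(\<integral>\<^sup>+\<omega>. ennreal (Q 0 \<omega>) \<partial>M) < \<infinity>"
  shows "(\<lambda>n. \<integral>\<^sup>+\<omega>. ennreal (Q n \<omega>) \<partial>M) \<longlonglongrightarrow> 0" "AE \<omega> in M. (\<lambda>n. Q n \<omega>) \<longlonglongrightarrow> 0"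
proof -
  note [measurable] = Qm
  let ?I = "\<lambda>n. \<integral>\<^sup>+\<omega>. ennreal (Q n \<omega>) \<partial>M"
  \<comment> \<open>A real majorant, solving the recursion with equality from the finite initial
    integral, so that the summability lemma for real sequences applies.\<close>
  define B where "B = rec_nat (enn2real (?I 0)) (\<lambda>n b. c n * b + e n)"
  have B_simps: "B 0 = enn2real (?I 0)" "B (Suc n) = c n * B n + e n" for n
    by (simp_all add: B_def)
  have B0: "0 \<le> B n" for n
    by (induction n) (simp_all add: B_simps c e)
  have IB: "?I n \<le> ennreal (B n)" for n
  proof (induction n)
    case 0
    show ?case using fin by (simp add: B_simps)
  next
    case (Suc n)
    interpret finite_measure_subalgebra M "F n"
      using F by (rule finite_measure_subalgebraI)
    \<comment> \<open>Testing against the constant 1 shows that conditioning preserves the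
      integral.\<close>
    have "?I (Suc n) = (\<integral>\<^sup>+\<omega>. nn_cond_exp M (F n) (\<lambda>\<omega>. ennreal (Q (Suc n) \<omega>)) \<omega> \<partial>M)"
      using nn_cond_exp_intg[of "\<lambda>_. 1" "\<lambda>\<omega>. ennreal (Q (Suc n) \<omega>)"] by simp
    also have "\<dots> \<le> (\<integral>\<^sup>+\<omega>. ennreal (c n) * ennreal (Q n \<omega>) + ennreal (e n) \<partial>M)"
      using step[of n] by (intro nn_integral_mono_AE) (simp add: ennreal_mult Q0 c e)
    also have "\<dots> = ennreal (c n) * ?I n + ennreal (e n)"
      by (simp add: nn_integral_add nn_integral_cmult emeasure_space_1)
    also have "\<dots> \<le> ennreal (c n) * ennreal (B n) + ennreal (e n)"
      using Suc by (intro add_mono mult_left_mono) auto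
    also have "\<dots> = ennreal (B (Suc n))"
      using B0 c e by (simp add: B_simps ennreal_mult)
    finally show ?case .
  qed
  have "summable B"
    by (rule summable_contraction_recursion[OF B0 _ \<rho> e(2,1)]) (simp add: B_simps)
  have "(\<lambda>n. ennreal (B n)) \<longlonglongrightarrow> ennreal 0"
    using summable_LIMSEQ_zero[OF \<open>summable B\<close>] by (intro tendsto_ennrealI)
  then show "?I \<longlonglongrightarrow> 0"
    using IB by (intro tendsto_sandwich[of "\<lambda>_. 0" ?I sequentially "\<lambda>n. ennreal (B n)"]) auto
  have "(\<integral>\<^sup>+\<omega>. (\<Sum>n. ennreal (Q n \<omega>)) \<partial>M) = (\<Sum>n. ?I n)"
    by (rule nn_integral_suminf) measurable
  also have "\<dots> \<le> (\<Sum>n. ennreal (B n))"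
    using IB by (intro suminf_le) auto
  also have "\<dots> = ennreal (\<Sum>n. B n)"
    using B0 \<open>summable B\<close> by (intro suminf_ennreal2) auto
  also have "\<dots> < \<infinity>" by simp
  finally have "AE \<omega> in M. (\<Sum>n. ennreal (Q n \<omega>)) \<noteq> \<infinity>"
    by (intro nn_integral_noteq_infinite) auto
  then show "AE \<omega> in M. (\<lambda>n. Q n \<omega>) \<longlonglongrightarrow> 0"
  proof eventually_elim
    case (elim \<omega>)
    then have "summable (\<lambda>n. Q n \<omega>)"
      using Q0 by (intro summable_suminf_not_top) auto
    then show ?case by (rule summable_LIMSEQ_zero)
  qed
qed

section \<open>Application to the randomly activated block iteration\<close>

lemma measurable_norm_vec_nth_borel_on:
  fixes f :: "'w \<Rightarrow> 'a::real_normed_vector ^ 'm::finite"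
  assumes "f \<in> N \<rightarrow>\<^sub>M borel_on S"
  shows "(\<lambda>\<omega>. norm (f \<omega> $ i - z)) \<in> borel_measurable N" "(\<lambda>\<omega>. norm (f \<omega>)) \<in> borel_measurable N"
proof -
  have f: "f \<in> N \<rightarrow>\<^sub>M borel"
    using assms by (simp add: borel_on_def measurable_restrict_space2_iff)
  show "(\<lambda>\<omega>. norm (f \<omega> $ i - z)) \<in> borel_measurable N"
    by (rule measurable_compose[OF f borel_measurable_continuous_onI]) (intro continuous_intros)
  show "(\<lambda>\<omega>. norm (f \<omega>)) \<in> borel_measurable N"
    by (rule measurable_compose[OF f borel_measurable_continuous_onI]) (intro continuous_intros)
qed

theorem theorem3p1:
  fixes M :: "'w measure"
    and H :: "'m::finite \<Rightarrow> 'a::{real_inner, complete_space, second_countable_topology} set"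
    and \<tau> :: "nat \<Rightarrow> 'm \<Rightarrow> real"
    and T :: "nat \<Rightarrow> 'a ^ 'm \<Rightarrow> 'a ^ 'm"
    and xbar :: "'a ^ 'm"
    and lam :: "nat \<Rightarrow> real"
    and x a :: "nat \<Rightarrow> 'w \<Rightarrow> 'a ^ 'm"
    and \<epsilon> :: "nat \<Rightarrow> 'w \<Rightarrow> real ^ 'm"
    and F :: "nat \<Rightarrow> 'w measure"
    and \<alpha> :: "nat \<Rightarrow> real"
    and p :: "'m \<Rightarrow> real"
  assumes "prob_space M"
    and "\<And>i. subspace (H i)" and "\<And>i. closed (H i)"
    and "\<And>n i. 0 \<le> \<tau> n i \<and> \<tau> n i < 1"
    and "\<And>n. T n \<in> borel_on (direct_sum H) \<rightarrow>\<^sub>M borel_on (direct_sum H)"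
    and "\<And>n. quasinonexpansive_on (direct_sum H) (T n)"
    and "\<And>n. xbar \<in> fixed_points (direct_sum H) (T n)"
    and "\<And>n y. y \<in> direct_sum H \<Longrightarrow>
           (norm (T n y - xbar))\<^sup>2 \<le> (\<Sum>i\<in>UNIV. \<tau> n i * (norm (y $ i - xbar $ i))\<^sup>2)"
    and "\<And>n. 0 < lam n \<and> lam n \<le> 1"
    and "x 0 \<in> M \<rightarrow>\<^sub>M borel_on (direct_sum H)"
    and "\<And>n. a n \<in> M \<rightarrow>\<^sub>M borel_on (direct_sum H)"
    and "\<And>n. \<epsilon> n \<in> M \<rightarrow>\<^sub>M count_space activation_patterns"
    and "\<And>n k. distr M (count_space activation_patterns) (\<epsilon> n)
               = distr M (count_space activation_patterns) (\<epsilon> k)"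
    and "\<And>n i \<omega>. \<omega> \<in> space M \<Longrightarrow>
           x (Suc n) \<omega> $ i = x n \<omega> $ i
             + (\<epsilon> n \<omega> $ i * lam n) *\<^sub>R (T n (x n \<omega>) $ i + a n \<omega> $ i - x n \<omega> $ i)"
    and "\<And>n. subalgebra M (F n)"
    and "\<And>n. generated_sigma M (borel_on (direct_sum H)) (x ` {..n}) \<subseteq> sets (F n)"
    and "\<And>n. sets (F n) \<subseteq> sets (F (Suc n))"
    and a: "(INF n. lam n) > 0"
    and b: "\<And>n. \<alpha> n \<ge> 0" "summable (\<lambda>n. sqrt (\<alpha> n))"
           "\<And>n. AE \<omega> in M. cond_sq_norm M (F n) (a n) \<omega> \<le> ennreal (\<alpha> n)"
    and c: "\<And>n. prob_space.indep_set M
              (generated_sigma M (count_space activation_patterns) {\<epsilon> n}) (sets (F n))"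
    and d: "\<And>i. p i = \<P>(\<omega> in M. \<epsilon> 0 \<omega> $ i = 1)" "\<And>i. p i > 0"
  shows
    "(\<forall>w xi mu chi eta.
        (\<forall>i. w i > 0) \<and>
        (\<forall>i. limsup (\<lambda>n. ereal (\<tau> n i)) < ereal (w i * p i)) \<and>
        Max (range (\<lambda>i. w i * p i)) = 1 \<and>
        (\<forall>n. xi n = \<alpha> n * Max (range w)) \<and>
        (\<forall>n. mu n = 1 - Min (range (\<lambda>i. p i - \<tau> n i / w i))) \<and>
        (\<forall>n. chi n = 1 - lam n * (1 - mu n)
                 + sqrt (xi n) * lam n * (1 - lam n + lam n * sqrt (mu n))) \<and>
        (\<forall>n. eta n = (\<Sum>k=0..n. (\<Prod>l=k+1..n. chi l) * lam k
                 * (1 - lam k + lam k * sqrt (mu k) + lam k * sqrt (xi k)) * sqrt (xi k)))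
        \<longrightarrow>
        (\<forall>n. AE \<omega> in M.
           (\<Sum>i\<in>UNIV. ennreal (w i)
              * cond_sq_norm M (F 0) (\<lambda>\<omega>'. x (Suc n) \<omega>' $ i - xbar $ i) \<omega>)
           \<le> ennreal ((\<Prod>k=0..n. chi k) * (\<Sum>i\<in>UNIV. w i * (norm (x 0 \<omega> $ i - xbar $ i))\<^sup>2)
                + eta n)))
     \<and>
     (integrable M (\<lambda>\<omega>. (norm (x 0 \<omega>))\<^sup>2) \<and> (\<forall>i. limsup (\<lambda>n. ereal (\<tau> n i)) < 1)
        \<longrightarrow>
        (\<lambda>n. \<integral>\<^sup>+ \<omega>. ennreal ((norm (x n \<omega> - xbar))\<^sup>2) \<partial>M) \<longlonglongrightarrow> 0 \<and>
        (AE \<omega> in M. (\<lambda>n. x n \<omega>) \<longlonglongrightarrow> xbar))"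
proof -
  interpret prob_space M by fact
  note H = \<open>\<And>i. subspace (H i)\<close>
  note \<tau> = \<open>\<And>n i. 0 \<le> \<tau> n i \<and> \<tau> n i < 1\<close>
  note T_meas = \<open>\<And>n. T n \<in> borel_on (direct_sum H) \<rightarrow>\<^sub>M borel_on (direct_sum H)\<close>
  note fixed = \<open>\<And>n. xbar \<in> fixed_points (direct_sum H) (T n)\<close>
  note T_le = \<open>\<And>n y. y \<in> direct_sum H \<Longrightarrow>
           (norm (T n y - xbar))\<^sup>2 \<le> (\<Sum>i\<in>UNIV. \<tau> n i * (norm (y $ i - xbar $ i))\<^sup>2)\<close>
  note lam = \<open>\<And>n. 0 < lam n \<and> lam n \<le> 1\<close>
  note x0_meas = \<open>x 0 \<in> M \<rightarrow>\<^sub>M borel_on (direct_sum H)\<close>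
  note a_meas = \<open>\<And>n. a n \<in> M \<rightarrow>\<^sub>M borel_on (direct_sum H)\<close>
  note \<epsilon>_meas = \<open>\<And>n. \<epsilon> n \<in> M \<rightarrow>\<^sub>M count_space activation_patterns\<close>
  note \<epsilon>_distr = \<open>\<And>n k. distr M (count_space activation_patterns) (\<epsilon> n)
               = distr M (count_space activation_patterns) (\<epsilon> k)\<close>
  note x_Suc = \<open>\<And>n i \<omega>. \<omega> \<in> space M \<Longrightarrow>
           x (Suc n) \<omega> $ i = x n \<omega> $ i
             + (\<epsilon> n \<omega> $ i * lam n) *\<^sub>R (T n (x n \<omega>) $ i + a n \<omega> $ i - x n \<omega> $ i)\<close>
  note F_sub = \<open>\<And>n. subalgebra M (F n)\<close>
  note x_F = \<open>\<And>n. generated_sigma M (borel_on (direct_sum H)) (x ` {..n}) \<subseteq> sets (F n)\<close>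
  note F_mono = \<open>\<And>n. sets (F n) \<subseteq> sets (F (Suc n))\<close>

  \<comment> \<open>Invariance of the direct sum and adaptedness of the iterates\<close>
  let ?S = "direct_sum H"
  have space_S: "space (borel_on ?S) = ?S"
    by (simp add: borel_on_def space_restrict_space)
  have space_F: "space (F n) = space M" for n
    using F_sub[of n] by (simp add: subalgebra_def)
  have xbar_S: "xbar \<in> ?S" using fixed[of 0] by (simp add: fixed_points_def)
  have T_S: "T n y \<in> ?S" if "y \<in> ?S" for n y
    using measurable_space[OF T_meas, of y n] that by (simp add: space_S)
  have a_S: "a n \<omega> \<in> ?S" if "\<omega> \<in> space M" for n \<omega>
    using measurable_space[OF a_meas that] by (simp add: space_S)
  \<comment> \<open>The bound on \<open>T n\<close> is available on the direct sum, so the iterates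
    must stay there: each coordinate results from linear operations inside the subspace
    \<open>H i\<close>.\<close>
  have x_S: "x n \<omega> \<in> ?S" if "\<omega> \<in> space M" for n \<omega>
  proof (induction n)
    case 0
    show ?case using measurable_space[OF x0_meas that] by (simp add: space_S)
  next
    case (Suc n)
    then show ?case
      using T_S[OF Suc, of n] a_S[OF that, of n] H
      by (auto simp: direct_sum_def x_Suc[OF that] intro!: subspace_add subspace_diff subspace_scale)
  qed
  have x_meas: "x n \<in> F n \<rightarrow>\<^sub>M borel_on ?S" for n
  proof (rule measurableI)
    fix A assume "A \<in> sets (borel_on ?S)"
    then have "x n -` A \<inter> space M \<in> generated_sigma M (borel_on ?S) (x ` {..n})"
      unfolding generated_sigma_def by (intro sigma_sets.Basic) auto
    then show "x n -` A \<inter> space (F n) \<in> sets (F n)"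
      using x_F[of n] by (auto simp: space_F)
  qed (simp add: space_F space_S x_S)
  have Tx_meas: "(\<lambda>\<omega>. T n (x n \<omega>)) \<in> F n \<rightarrow>\<^sub>M borel_on ?S" for n
    by (rule measurable_compose[OF x_meas T_meas])
  have x_meas_M: "x n \<in> M \<rightarrow>\<^sub>M borel_on ?S" for n
    by (rule measurable_from_subalg[OF F_sub x_meas])

  \<comment> \<open>Activation events, their probabilities and their independence of the
    past\<close>
  define E where "E n i = \<epsilon> n -` {d \<in> activation_patterns. d $ i = 1} \<inter> space M" for n i
  have E_gen: "E n i \<in> generated_sigma M (count_space activation_patterns) {\<epsilon> n}" for n i
    unfolding generated_sigma_def E_def
    by (intro sigma_sets.Basic CollectI exI[of _ "\<epsilon> n"] exI[of _ "{d \<in> activation_patterns. d $ i = 1}"]) auto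
  have E_events: "E n i \<in> events" for n i
    unfolding E_def by (rule measurable_sets[OF \<epsilon>_meas]) auto
  have \<epsilon>_pattern: "\<epsilon> n \<omega> \<in> activation_patterns" if "\<omega> \<in> space M" for n \<omega>
    using measurable_space[OF \<epsilon>_meas that] by simp
  have E_ind: "indicator (E n i) \<omega> = \<epsilon> n \<omega> $ i" if "\<omega> \<in> space M" for n i \<omega>
    using \<epsilon>_pattern[OF that, of n] that by (auto simp: E_def activation_patterns_def indicator_def)
  \<comment> \<open>Equality in law carries the value at time 0 to every \<open>n\<close>.\<close>
  have prob_E: "prob (E n i) = p i" for n i
  proof -
    have "prob (E n i) = measure (distr M (count_space activation_patterns) (\<epsilon> n)) {d \<in> activation_patterns. d $ i = 1}" for n
      unfolding E_def by (rule measure_distr[symmetric, OF \<epsilon>_meas]) auto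
    then have "prob (E n i) = prob (E 0 i)"
      using \<epsilon>_distr[of n 0] by simp
    also have "E 0 i = {\<omega> \<in> space M. \<epsilon> 0 \<omega> $ i = 1}"
      using \<epsilon>_pattern by (auto simp: E_def)
    finally show ?thesis using d(1) by simp
  qed
  have p_le_1: "p i \<le> 1" for i using prob_le_1[of "E 0 i"] by (simp add: prob_E)
  \<comment> \<open>Independence of the past is used one block at a time; the entries of
    \<open>\<epsilon> n\<close> may depend on one another.\<close>
  have indep_E: "prob (A \<inter> E n i) = prob A * prob (E n i)" if "A \<in> sets (F n)" for A n i
    using indep_setD[OF c E_gen that] by (simp add: Int_commute mult.commute)

  \<comment> \<open>The weighted squared distance to \<open>xbar\<close> and its one-step
    estimate\<close>
  define Q where "Q w n \<omega> = (\<Sum>i\<in>UNIV. w i * (norm (x n \<omega> $ i - xbar $ i))\<^sup>2)" for w :: "'m \<Rightarrow> real" and n \<omega>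
  define Mu where "Mu w n = 1 - Min (range (\<lambda>i. p i - \<tau> n i / w i))" for w n
  define Xi where "Xi w n = \<alpha> n * Max (range w)" for w :: "'m \<Rightarrow> real" and n
  define Chi where "Chi w n = 1 - lam n * (1 - Mu w n)
     + sqrt (Xi w n) * lam n * (1 - lam n + lam n * sqrt (Mu w n))" for w n
  define Eta where "Eta w n = lam n * (1 - lam n + lam n * sqrt (Mu w n)
     + lam n * sqrt (Xi w n)) * sqrt (Xi w n)" for w n
  have coord_F: "(\<lambda>\<omega>. norm (x n \<omega> $ i - xbar $ i)) \<in> borel_measurable (F n)" for n i
    by (rule measurable_norm_vec_nth_borel_on[OF x_meas])
  have Q_F: "Q w n \<in> borel_measurable (F n)" for w n
    unfolding Q_def using coord_F by measurable
  have Q_nonneg: "0 \<le> Q w n \<omega>" if "\<And>i. 0 < w i" for w n \<omega>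
    unfolding Q_def using that by (intro sum_nonneg mult_nonneg_nonneg) (auto intro: less_imp_le)
  have Mu_nonneg: "0 \<le> Mu w n" if "\<And>i. 0 < w i" for w n
  proof -
    fix i :: 'm
    have "Min (range (\<lambda>i. p i - \<tau> n i / w i)) \<le> p i - \<tau> n i / w i" by simp
    also have "\<dots> \<le> 1"
      using p_le_1[of i] \<tau>[of n i] that[of i] by (smt (verit) divide_nonneg_pos)
    finally show ?thesis by (simp add: Mu_def)
  qed
  have Xi_nonneg: "0 \<le> Xi w n" if "\<And>i. 0 < w i" for w n
  proof -
    have "0 < Max (range w)" using that by (simp add: Max_gr_iff)
    then show ?thesis using b(1)[of n] by (simp add: Xi_def)
  qed
  \<comment> \<open>Iterating the inequality needs nonnegative factors; \<open>lam n \<le> 1\<close>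
    and \<open>Mu w n \<ge> 0\<close> keep \<open>lam n * (1 - Mu w n)\<close> below 1.\<close>
  have Chi_nonneg: "0 \<le> Chi w n" if w: "\<And>i. 0 < w i" for w n
  proof -
    have "lam n * (1 - Mu w n) \<le> 1 * 1"
      using lam[of n] Mu_nonneg[of w n, OF w] by (smt (verit) mult_left_le mult_cancel_left1)
    moreover have "0 \<le> sqrt (Xi w n) * lam n * (1 - lam n + lam n * sqrt (Mu w n))"
      using lam[of n] Mu_nonneg[of w n, OF w] Xi_nonneg[of w n, OF w]
      by (intro mult_nonneg_nonneg add_nonneg_nonneg) auto
    ultimately show ?thesis by (simp add: Chi_def)
  qed
  have Eta_nonneg: "0 \<le> Eta w n" if w: "\<And>i. 0 < w i" for w n
    unfolding Eta_def using lam[of n] Mu_nonneg[of w n, OF w] Xi_nonneg[of w n, OF w]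
    by (intro mult_nonneg_nonneg add_nonneg_nonneg) auto
  \<comment> \<open>Subtracting \<open>xbar\<close> from the iterate and from its image under
    \<open>T n\<close> leaves the form of the update unchanged. The condition
    \<open>w i * p i \<le> 1\<close> covers both the normalized weights of the first claim and the
    weights \<open>1 / p i\<close> of the second.\<close>
  have step: "AE \<omega> in M. nn_cond_exp M (F n) (\<lambda>\<omega>. ennreal (Q w (Suc n) \<omega>)) \<omega>
      \<le> ennreal (Chi w n * Q w n \<omega> + Eta w n)"
    if w: "\<And>i. 0 < w i" "\<And>i. w i * p i \<le> 1" for w n
  proof -
    have "AE \<omega> in M. nn_cond_exp M (F n)
        (\<lambda>\<omega>. ennreal (\<Sum>i\<in>UNIV. w i * (norm ((x (Suc n) \<omega> - xbar) $ i))\<^sup>2)) \<omega>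
      \<le> ennreal (Chi w n * (\<Sum>i\<in>UNIV. w i * (norm ((x n \<omega> - xbar) $ i))\<^sup>2) + Eta w n)"
    proof (rule cond_exp_block_step[where E = "E n" and a = "a n" and v = "\<lambda>\<omega>. T n (x n \<omega>) - xbar"
            and t = "\<tau> n" and l = "lam n" and \<alpha> = "\<alpha> n" and xi = "Xi w n" and mu = "Mu w n"])
      fix \<omega> i assume \<omega>: "\<omega> \<in> space M"
      show "(x (Suc n) \<omega> - xbar) $ i = (x n \<omega> - xbar) $ i + (indicator (E n i) \<omega> * lam n) *\<^sub>R
          ((T n (x n \<omega>) - xbar) $ i + a n \<omega> $ i - (x n \<omega> - xbar) $ i)"
        by (simp add: E_ind[OF \<omega>] x_Suc[OF \<omega>] algebra_simps)
      show "(norm (T n (x n \<omega>) - xbar))\<^sup>2 \<le> (\<Sum>i\<in>UNIV. \<tau> n i * (norm ((x n \<omega> - xbar) $ i))\<^sup>2)"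
        using T_le[OF x_S[OF \<omega>], of n] by simp
    qed (use F_sub E_events indep_E w \<tau> lam b in
        \<open>auto simp: prob_E Xi_def Mu_def Chi_def Eta_def less_imp_le
           intro!: measurable_norm_vec_nth_borel_on[OF x_meas] measurable_norm_vec_nth_borel_on[OF x_meas_M]
             measurable_norm_vec_nth_borel_on[OF Tx_meas] measurable_norm_vec_nth_borel_on[OF a_meas]\<close>)
    then show ?thesis by (simp add: Q_def)
  qed

  show ?thesis
  proof (intro conjI allI impI)

    \<comment> \<open>The conditional bound given \<open>F 0\<close>\<close>
    fix w xi mu chi eta n
    assume asm: "(\<forall>i. w i > 0) \<and>
        (\<forall>i. limsup (\<lambda>n. ereal (\<tau> n i)) < ereal (w i * p i)) \<and>
        Max (range (\<lambda>i. w i * p i)) = 1 \<and>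
        (\<forall>n. xi n = \<alpha> n * Max (range w)) \<and>
        (\<forall>n. mu n = 1 - Min (range (\<lambda>i. p i - \<tau> n i / w i))) \<and>
        (\<forall>n. chi n = 1 - lam n * (1 - mu n)
                 + sqrt (xi n) * lam n * (1 - lam n + lam n * sqrt (mu n))) \<and>
        (\<forall>n. eta n = (\<Sum>k=0..n. (\<Prod>l=k+1..n. chi l) * lam k
                 * (1 - lam k + lam k * sqrt (mu k) + lam k * sqrt (xi k)) * sqrt (xi k)))"
    then have w: "\<And>i. 0 < w i" by blast
    have wp: "w i * p i \<le> 1" for i
      using asm Max_ge[of "range (\<lambda>i. w i * p i)" "w i * p i"] by simp
    have xi: "xi = Xi w" and mu: "mu = Mu w" using asm by (auto simp: Xi_def Mu_def)
    then have chi: "chi = Chi w" using asm by (auto simp: Chi_def)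
    have eta: "eta n = (\<Sum>k=0..n. (\<Prod>l=k+1..n. Chi w l) * Eta w k)"
      using asm by (simp add: xi mu chi Eta_def mult.assoc)
    interpret F0: finite_measure_subalgebra M "F 0"
      using F_sub by (rule finite_measure_subalgebraI)
    let ?f = "\<lambda>i \<omega>. ennreal ((norm (x (Suc n) \<omega> $ i - xbar $ i))\<^sup>2)"
    have [measurable]: "(\<lambda>\<omega>. norm (x n \<omega> $ i - xbar $ i)) \<in> borel_measurable M" for n i
      by (rule measurable_norm_vec_nth_borel_on[OF x_meas_M])
    \<comment> \<open>The claim weights blockwise conditional expectations; linearity identifies
      their sum with the conditional expectation of \<open>Q w (Suc n)\<close>.\<close>
    have "AE \<omega> in M. \<forall>i. nn_cond_exp M (F 0) (\<lambda>\<omega>. ennreal (w i) * ?f i \<omega>) \<omega>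
        = ennreal (w i) * nn_cond_exp M (F 0) (?f i) \<omega>"
      by (unfold AE_all_countable) (auto intro!: F0.nn_cond_exp_cmult)
    moreover have "AE \<omega> in M. nn_cond_exp M (F 0) (\<lambda>\<omega>. \<Sum>i\<in>UNIV. ennreal (w i) * ?f i \<omega>) \<omega>
        = (\<Sum>i\<in>UNIV. nn_cond_exp M (F 0) (\<lambda>\<omega>. ennreal (w i) * ?f i \<omega>) \<omega>)"
      by (rule F0.nn_cond_exp_finite_sum) auto
    moreover have "(\<lambda>\<omega>. \<Sum>i\<in>UNIV. ennreal (w i) * ?f i \<omega>) = (\<lambda>\<omega>. ennreal (Q w (Suc n) \<omega>))"
      using w by (simp add: Q_def ennreal_mult[symmetric] less_imp_le)
    moreover have "AE \<omega> in M. nn_cond_exp M (F 0) (\<lambda>\<omega>. ennreal (Q w (Suc n) \<omega>)) \<omega>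
        \<le> ennreal ((\<Prod>k=0..n. Chi w k) * Q w 0 \<omega> + (\<Sum>k=0..n. (\<Prod>l=k+1..n. Chi w l) * Eta w k))"
      by (rule cond_exp_affine_recursion[where F = F and Q = "Q w" and c = "Chi w" and e = "Eta w", OF F_sub F_mono Q_F Q_nonneg[of w, OF w] step[of w, OF w wp]
            Chi_nonneg[of w, OF w] Eta_nonneg[of w, OF w]])
    ultimately show "AE \<omega> in M.
           (\<Sum>i\<in>UNIV. ennreal (w i)
              * cond_sq_norm M (F 0) (\<lambda>\<omega>'. x (Suc n) \<omega>' $ i - xbar $ i) \<omega>)
           \<le> ennreal ((\<Prod>k=0..n. chi k) * (\<Sum>i\<in>UNIV. w i * (norm (x 0 \<omega> $ i - xbar $ i))\<^sup>2)
                + eta n)"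
      by (auto simp: cond_sq_norm_def eta chi Q_def)
  next

    \<comment> \<open>Mean-square and almost sure convergence\<close>
    assume asm: "integrable M (\<lambda>\<omega>. (norm (x 0 \<omega>))\<^sup>2) \<and> (\<forall>i. limsup (\<lambda>n. ereal (\<tau> n i)) < 1)"
    \<comment> \<open>These weights make every \<open>w i * p i\<close> equal to 1, and since they
      are at least 1, \<open>Q w n\<close> dominates the squared distance.\<close>
    define w where "w i = 1 / p i" for i
    have w: "0 < w i" "w i * p i \<le> 1" "1 \<le> w i" for i
      using d(2)[of i] p_le_1[of i] by (auto simp: w_def)
    have le_Q: "(norm (x n \<omega> - xbar))\<^sup>2 \<le> Q w n \<omega>" for n \<omega>
      unfolding norm_sq_vec Q_def
    proof (rule sum_mono)
      show "(norm ((x n \<omega> - xbar) $ i))\<^sup>2 \<le> w i * (norm (x n \<omega> $ i - xbar $ i))\<^sup>2" for i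
        using mult_right_mono[OF w(3)[of i] zero_le_power2[of "norm (x n \<omega> $ i - xbar $ i)"]] by simp
    qed
    have \<tau>w: "\<tau> n i / w i = \<tau> n i * p i" for n i by (simp add: w_def)
    have Mu_le_1: "Mu w n \<le> 1" for n
      using d(2) \<tau>[of n] by (auto simp: Mu_def \<tau>w mult_left_le_one_le less_imp_le)
    have "\<exists>\<theta><1. \<forall>\<^sub>F n in sequentially. \<tau> n i \<le> \<theta>" for i
    proof -
      have "limsup (\<lambda>n. ereal (\<tau> n i)) < ereal 1" using asm by (simp add: one_ereal_def)
      from ereal_dense2[OF this] obtain \<theta> where \<theta>: "limsup (\<lambda>n. ereal (\<tau> n i)) < ereal \<theta>" "ereal \<theta> < ereal 1"
        by blast
      from Limsup_lessD[OF \<theta>(1)] have "\<forall>\<^sub>F n in sequentially. \<tau> n i \<le> \<theta>"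
        by (rule eventually_mono) simp
      with \<theta>(2) show ?thesis by auto
    qed
    then obtain \<theta> where \<theta>: "\<And>i. \<theta> i < 1" "\<And>i. \<forall>\<^sub>F n in sequentially. \<tau> n i \<le> \<theta> i"
      by metis
    \<comment> \<open>A uniform gap: once \<open>\<tau> n i \<le> \<theta> i\<close> for all
      \<open>i\<close>, each \<open>p i - \<tau> n i / w i\<close> is at least
      \<open>p i * (1 - \<theta> i)\<close>.\<close>
    define \<delta> where "\<delta> = Min (range (\<lambda>i. p i * (1 - \<theta> i)))"
    have "0 < \<delta>" using d(2) \<theta>(1) by (simp add: \<delta>_def)
    have "\<forall>\<^sub>F n in sequentially. \<forall>i. \<tau> n i \<le> \<theta> i"
      using \<theta>(2) by (simp add: eventually_all_finite)
    then have Mu_le: "\<forall>\<^sub>F n in sequentially. \<delta> \<le> 1 - Mu w n"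
    proof eventually_elim
      case (elim n)
      have "\<delta> \<le> p i - \<tau> n i * p i" for i
      proof -
        have "\<delta> \<le> p i * (1 - \<theta> i)" by (simp add: \<delta>_def)
        also have "\<dots> \<le> p i * (1 - \<tau> n i)" using elim d(2)[of i] by simp
        finally show ?thesis by (simp add: algebra_simps)
      qed
      then show ?case by (simp add: Mu_def \<tau>w)
    qed
    define \<kappa> where "\<kappa> = (INF n. lam n)"
    have "0 < \<kappa>" using a by (simp add: \<kappa>_def)
    have \<kappa>: "\<kappa> \<le> lam n" for n
      unfolding \<kappa>_def by (rule cINF_lower) (use lam in \<open>auto intro!: bdd_belowI[of _ 0] less_imp_le\<close>)
    have sqrt_Xi: "sqrt (Xi w n) = sqrt (Max (range w)) * sqrt (\<alpha> n)" for n
      by (simp add: Xi_def real_sqrt_mult)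
    have sum_Xi: "summable (\<lambda>n. sqrt (Xi w n))"
      unfolding sqrt_Xi by (intro summable_mult b(2))
    have Xi_lim: "(\<lambda>n. sqrt (Xi w n)) \<longlonglongrightarrow> 0"
      by (rule summable_LIMSEQ_zero[OF sum_Xi])
    \<comment> \<open>As \<open>Mu w n \<le> 1\<close>, the inner convex combination of 1 and
      \<open>sqrt (Mu w n)\<close> is at most 1.\<close>
    have factor_le_1: "lam n * (1 - lam n + lam n * sqrt (Mu w n)) \<le> 1" for n
    proof -
      have "lam n * sqrt (Mu w n) \<le> lam n * 1"
        using lam[of n] Mu_le_1[of n] by (intro mult_left_mono) auto
      then have "lam n * (1 - lam n + lam n * sqrt (Mu w n)) \<le> lam n * 1"
        using lam[of n] by (intro mult_left_mono) auto
      then show ?thesis using lam[of n] by linarith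
    qed
    have "\<forall>\<^sub>F n in sequentially. sqrt (Xi w n) < \<kappa> * \<delta> / 2"
      using Xi_lim \<open>0 < \<kappa>\<close> \<open>0 < \<delta>\<close> by (intro order_tendstoD) auto
    \<comment> \<open>The gap is at least \<open>\<kappa> * \<delta>\<close>; half of it absorbs the
      error part of \<open>Chi\<close>, which is at most \<open>sqrt (Xi w n)\<close>.\<close>
    with Mu_le have Chi_le: "\<forall>\<^sub>F n in sequentially. Chi w n \<le> 1 - \<kappa> * \<delta> / 2"
    proof eventually_elim
      case (elim n)
      have "\<kappa> * \<delta> \<le> lam n * (1 - Mu w n)"
        using elim(1) \<kappa>[of n] \<open>0 < \<kappa>\<close> \<open>0 < \<delta>\<close> by (intro mult_mono) auto
      moreover have "sqrt (Xi w n) * (lam n * (1 - lam n + lam n * sqrt (Mu w n))) \<le> sqrt (Xi w n) * 1"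
        using Xi_nonneg[of w, OF w(1)] by (intro mult_left_mono factor_le_1) auto
      ultimately show ?case using elim(2) by (simp add: Chi_def mult.assoc)
    qed
    have "\<forall>\<^sub>F n in sequentially. sqrt (Xi w n) < 1"
      using Xi_lim by (intro order_tendstoD) auto
    \<comment> \<open>The constant 2 is 1 from \<open>factor_le_1\<close> plus 1 from
      \<open>lam n * lam n * sqrt (Xi w n)\<close>, so \<open>Eta\<close> inherits summability from
      \<open>sqrt (Xi w n)\<close>.\<close>
    then have "\<forall>\<^sub>F n in sequentially. norm (Eta w n) \<le> 2 * sqrt (Xi w n)"
    proof eventually_elim
      case (elim n)
      have "lam n * lam n * sqrt (Xi w n) \<le> 1 * 1 * 1"
        using lam[of n] elim Xi_nonneg[of w, OF w(1)] by (intro mult_mono) auto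
      then have "lam n * (1 - lam n + lam n * sqrt (Mu w n) + lam n * sqrt (Xi w n)) \<le> 2"
        using factor_le_1[of n] by (simp add: algebra_simps)
      then show ?case
        using Eta_nonneg[of w n, OF w(1)] Xi_nonneg[of w n, OF w(1)]
        by (auto simp: Eta_def intro!: mult_right_mono)
    qed
    then have sum_Eta: "summable (Eta w)"
      by (rule summable_comparison_test_ev) (intro summable_mult sum_Xi)
    have Q_M: "Q w n \<in> borel_measurable M" for n
      by (rule measurable_from_subalg[OF F_sub Q_F])
    have fin: "(\<integral>\<^sup>+\<omega>. ennreal (Q w 0 \<omega>) \<partial>M) < \<infinity>"
    proof -
      let ?W = "Max (range w)"
      have W: "w i \<le> ?W" for i by simp
      have Q_le: "Q w 0 \<omega> \<le> 2 * ?W * (norm (x 0 \<omega>))\<^sup>2 + 2 * ?W * (norm xbar)\<^sup>2" for \<omega>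
      proof -
        have "Q w 0 \<omega> \<le> (\<Sum>i\<in>UNIV. ?W * (norm ((x 0 \<omega> - xbar) $ i))\<^sup>2)"
          unfolding Q_def by (intro sum_mono) (simp add: mult_right_mono)
        also have "\<dots> = ?W * (norm (x 0 \<omega> - xbar))\<^sup>2"
          by (simp add: norm_sq_vec sum_distrib_left)
        also have "\<dots> \<le> ?W * (2 * (norm (x 0 \<omega>))\<^sup>2 + 2 * (norm xbar)\<^sup>2)"
        proof (rule mult_left_mono)
          have "(norm (x 0 \<omega> - xbar))\<^sup>2 \<le> (norm (x 0 \<omega>) + norm xbar)\<^sup>2"
            by (intro power_mono norm_triangle_ineq4) auto
          also have "\<dots> \<le> 2 * (norm (x 0 \<omega>))\<^sup>2 + 2 * (norm xbar)\<^sup>2"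
            using zero_le_power2[of "norm (x 0 \<omega>) - norm xbar"] by (simp add: power2_eq_square algebra_simps)
          finally show "(norm (x 0 \<omega> - xbar))\<^sup>2 \<le> 2 * (norm (x 0 \<omega>))\<^sup>2 + 2 * (norm xbar)\<^sup>2" .
          show "0 \<le> ?W" using W w(1) by (meson less_imp_le order_trans)
        qed
        finally show ?thesis by (simp add: algebra_simps)
      qed
      have int: "integrable M (\<lambda>\<omega>. 2 * ?W * (norm (x 0 \<omega>))\<^sup>2 + 2 * ?W * (norm xbar)\<^sup>2)"
        using asm by (intro Bochner_Integration.integrable_add integrable_mult_right) auto
      have "integrable M (Q w 0)"
      proof (rule Bochner_Integration.integrable_bound[OF int Q_M])
        show "AE \<omega> in M. norm (Q w 0 \<omega>) \<le> norm (2 * ?W * (norm (x 0 \<omega>))\<^sup>2 + 2 * ?W * (norm xbar)\<^sup>2)"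
          using Q_le Q_nonneg[of w, OF w(1)] by (intro AE_I2) (smt (verit) real_norm_def)
      qed
      then show ?thesis
        using Q_nonneg[of w, OF w(1)] by (simp add: integrable_iff_bounded)
    qed
    have \<rho>: "1 - \<kappa> * \<delta> / 2 < 1" using \<open>0 < \<kappa>\<close> \<open>0 < \<delta>\<close> by simp
    note lims = cond_exp_affine_contraction[where F = F and Q = "Q w" and c = "Chi w" and e = "Eta w", OF F_sub Q_M Q_nonneg[of w, OF w(1)] step[of w, OF w(1,2)]
        Chi_nonneg[of w, OF w(1)] Eta_nonneg[of w, OF w(1)] sum_Eta Chi_le \<rho> fin]
    show "(\<lambda>n. \<integral>\<^sup>+ \<omega>. ennreal ((norm (x n \<omega> - xbar))\<^sup>2) \<partial>M) \<longlonglongrightarrow> 0"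
      by (rule tendsto_sandwich[OF _ _ tendsto_const lims(1)])
        (auto intro!: always_eventually nn_integral_mono ennreal_leI le_Q)
    show "AE \<omega> in M. (\<lambda>n. x n \<omega>) \<longlonglongrightarrow> xbar"
      using lims(2)
    proof eventually_elim
      case (elim \<omega>)
      have "(\<lambda>n. (norm (x n \<omega> - xbar))\<^sup>2) \<longlonglongrightarrow> 0"
        by (rule tendsto_sandwich[OF _ _ tendsto_const elim]) (auto intro!: always_eventually le_Q)
      then have "(\<lambda>n. norm (x n \<omega> - xbar)) \<longlonglongrightarrow> 0"
        using tendsto_real_sqrt by fastforce
      then show ?case by (simp add: LIM_zero_iff tendsto_norm_zero_iff)
    qed
  qed
qed

end
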